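(* Let $G,H$ be bipartite graphs of order $n$, let $e$ be a cut edge of $G$ and $e'$ a cut edge of $H$, and let $G(k)$, $H(k)$ be the $k$-subdivision graphs of $G$ on $e$ and of $H$ on $e'$, respectively. If $G(0)\preccurlyeq H(0)$ and $G(1)\preccurlyeq H(1)$, then $G(k)\preccurlyeq H(k)$ for all $k\ge 2$, with $G(k)\sim H(k)$ if and only if both $H(0)\sim G(0)$ and $H(1)\sim G(1)$ hold.
   Context: For a graph $G$ of order $n$, $\phi(G,x)=\det(xI-A(G))=\sum_{i=0}^n a_i(G)x^{n-i}$ and $\widetilde{\phi}(G,x)=\sum_{i=0}^n |a_i(G)|x^{n-i}$. For bipartite graphs $G_1,G_2$ of the same order, $G_1\preccurlyeq G_2$ means every coefficient of $\widetilde{\phi}(G_1,x)$ is at most the corresponding coefficient of $\widetilde{\phi}(G_2,x)$; $G_1\sim G_2$ means $\widetilde{\phi}(G_1,x)=\widetilde{\phi}(G_2,x)$; $G_1\prec G_2$ means $G_1\preccurlyeq G_2$ and not $G_1\sim G_2$. For a cut edge $e$ of $G$, the $k$-subdivision graph $G(k)$ on $e$ is obtained by replacing $e$ with a path of length $k+1$; $G(0)=G$. *)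

theory Defs
  imports
    "Graph_Theory.Digraph_Component"
    "Graph_Theory.Vertex_Walk"
    "Jordan_Normal_Form.Char_Poly"
begin

text \<open>
  A finite simple undirected graph is a \<^locale>\<open>pair_graph\<close>: the undirected edge between
  u and v is represented by the two arcs (u, v) and (v, u).
\<close>

definition bipartite :: "'a pair_pre_digraph \<Rightarrow> bool" where
  "bipartite G \<longleftrightarrow> (\<exists>X Y. X \<union> Y = pverts G \<and> X \<inter> Y = {} \<and>
     (\<forall>(u, v) \<in> parcs G. (u \<in> X \<and> v \<in> Y) \<or> (u \<in> Y \<and> v \<in> X)))"

definition del_edge :: "'a pair_pre_digraph \<Rightarrow> 'a \<times> 'a \<Rightarrow> 'a pair_pre_digraph" where
  "del_edge G e = G\<lparr>parcs := parcs G - {e, prod.swap e}\<rparr>"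

text \<open>
  In a symmetric digraph the strongly connected components are the connected components of the
  undirected graph.
\<close>

definition cut_edge :: "'a pair_pre_digraph \<Rightarrow> 'a \<times> 'a \<Rightarrow> bool" where
  "cut_edge G e \<longleftrightarrow> e \<in> parcs G \<and>
     card (pre_digraph.sccs_verts (with_proj (del_edge G e)))
       > card (pre_digraph.sccs_verts (with_proj G))"


definition adjacency_matrix :: "'a list \<Rightarrow> 'a pair_pre_digraph \<Rightarrow> int mat" where
  "adjacency_matrix vs G =
     mat (length vs) (length vs) (\<lambda>(i, j). if (vs ! i, vs ! j) \<in> parcs G then 1 else 0)"

text \<open>
  The choice of the enumeration of the vertices is irrelevant, see \<open>graph_char_poly_eq\<close> below.
\<close>

definition graph_char_poly :: "'a pair_pre_digraph \<Rightarrow> int poly" where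
  "graph_char_poly G =
     char_poly (adjacency_matrix (SOME vs. distinct vs \<and> set vs = pverts G) G)"

definition phi_coeff :: "'a pair_pre_digraph \<Rightarrow> nat \<Rightarrow> int" where
  "phi_coeff G i = coeff (graph_char_poly G) (card (pverts G) - i)"

definition phi_tilde :: "'a pair_pre_digraph \<Rightarrow> int poly" where
  "phi_tilde G =
     (\<Sum>i = 0..card (pverts G). monom \<bar>phi_coeff G i\<bar> (card (pverts G) - i))"

text \<open>
  Both relations are meant for bipartite graphs of the same order only.
\<close>

definition quasi_le :: "'a pair_pre_digraph \<Rightarrow> 'b pair_pre_digraph \<Rightarrow> bool"
    (infix \<open>\<preceq>\<^sub>\<phi>\<close> 50) where
  "G \<preceq>\<^sub>\<phi> H \<longleftrightarrow> (\<forall>i. coeff (phi_tilde G) i \<le> coeff (phi_tilde H) i)"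

definition quasi_eq :: "'a pair_pre_digraph \<Rightarrow> 'b pair_pre_digraph \<Rightarrow> bool"
    (infix \<open>\<sim>\<^sub>\<phi>\<close> 50) where
  "G \<sim>\<^sub>\<phi> H \<longleftrightarrow> phi_tilde G = phi_tilde H"


text \<open>
  The edge uv is replaced by the path u, 0, 1, ..., k - 1, v of length k + 1; the old vertices are
  tagged with \<^term>\<open>Inl\<close> and the new ones with \<^term>\<open>Inr\<close>, so that for k = 0 one
  obtains a copy of G (see \<open>k_subdivision_0\<close>).
\<close>

definition subdivision_path :: "'a \<times> 'a \<Rightarrow> nat \<Rightarrow> ('a + nat) list" where
  "subdivision_path e k = Inl (fst e) # map Inr [0..<k] @ [Inl (snd e)]"

definition k_subdivision ::
    "'a pair_pre_digraph \<Rightarrow> 'a \<times> 'a \<Rightarrow> nat \<Rightarrow> ('a + nat) pair_pre_digraph" where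
  "k_subdivision G e k =
     \<lparr>pverts = Inl ` pverts G \<union> set (subdivision_path e k),
      parcs = map_prod Inl Inl ` parcs (del_edge G e)
        \<union> symcl (set (vwalk_arcs (subdivision_path e k)))\<rparr>"


lemma adjacency_matrix_carrier [simp]:
  "adjacency_matrix vs G \<in> carrier_mat (length vs) (length vs)"
  by (simp add: adjacency_matrix_def)

lemma det_permute_rows_cols:
  assumes A: "A \<in> carrier_mat n n" and p: "p permutes {0..<n::nat}"
  shows "det (mat n n (\<lambda>(i, j). A $$ (p i, p j))) = det A"
proof -
  define B where "B = mat n n (\<lambda>(i, j). A $$ (p i, j))"
  define C where "C = mat n n (\<lambda>(i, j). transpose_mat B $$ (p i, j))"
  have pn: "p i < n" if "i < n" for i
    using permutes_in_image[OF p, of i] that by auto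
  have B: "B \<in> carrier_mat n n" by (simp add: B_def)
  have BT: "transpose_mat B \<in> carrier_mat n n" using B by simp
  have C: "C \<in> carrier_mat n n" by (simp add: C_def)
  have eq: "mat n n (\<lambda>(i, j). A $$ (p i, p j)) = transpose_mat C"
    by (rule eq_matI) (auto simp: C_def B_def pn)
  have "det (transpose_mat C) = det C" by (rule det_transpose[OF C])
  also have "\<dots> = signof p * det (transpose_mat B)"
    unfolding C_def by (rule det_permute_rows[OF BT p])
  also have "det (transpose_mat B) = det B" by (rule det_transpose[OF B])
  also have "det B = signof p * det A"
    unfolding B_def by (rule det_permute_rows[OF A p])
  finally have "det (transpose_mat C) = (signof p * signof p) * det A"
    by (simp add: mult.assoc)
  also have "(signof p * signof p :: 'a) = 1"
    by (simp add: sign_def)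
  finally show ?thesis using eq by simp
qed

lemma char_poly_adjacency_matrix_perm:
  assumes "distinct vs" "distinct ws" "set vs = set ws"
  shows "char_poly (adjacency_matrix ws G) = char_poly (adjacency_matrix vs G)"
proof -
  have "mset ws = mset vs"
    using assms by (simp add: set_eq_iff_mset_eq_distinct)
  then obtain p where p: "p permutes {..<length vs}" and ws: "permute_list p vs = ws"
    using mset_eq_permutation by metis
  define n where "n = length vs"
  have p': "p permutes {0..<n}" using p by (simp add: n_def lessThan_atLeast0)
  have len: "length ws = n" using ws by (auto simp: n_def)
  have nth: "ws ! i = vs ! p i" if "i < n" for i
    using permute_list_nth[OF p] that ws by (auto simp: n_def)
  have pn: "p i < n" if "i < n" for i
    using permutes_in_image[OF p', of i] that by auto
  have inj: "p i = p j \<longleftrightarrow> i = j" for i j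
    using permutes_inj[OF p'] by (auto dest: injD)
  let ?M = "char_poly_matrix (adjacency_matrix vs G)"
  have M: "?M \<in> carrier_mat n n" by (simp add: n_def)
  have "char_poly_matrix (adjacency_matrix ws G) = mat n n (\<lambda>(i, j). ?M $$ (p i, p j))"
    by (rule eq_matI)
      (auto simp: char_poly_matrix_def adjacency_matrix_def len nth pn inj n_def[symmetric])
  then show ?thesis
    unfolding char_poly_def using det_permute_rows_cols[OF M p'] by simp
qed

lemma graph_char_poly_eq:
  assumes "distinct vs" "set vs = pverts G"
  shows "graph_char_poly G = char_poly (adjacency_matrix vs G)"
proof -
  define ws where "ws = (SOME vs. distinct vs \<and> set vs = pverts G)"
  have "distinct ws \<and> set ws = pverts G"
    unfolding ws_def by (rule someI[where x = vs]) (use assms in simp)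
  then show ?thesis
    using char_poly_adjacency_matrix_perm[of vs ws G] assms
    by (simp add: graph_char_poly_def ws_def)
qed

lemma k_subdivision_0:
  assumes "pair_graph G" "e \<in> parcs G"
  shows "k_subdivision G e 0 =
    \<lparr>pverts = Inl ` pverts G, parcs = map_prod Inl Inl ` parcs G\<rparr>"
proof -
  interpret pair_graph G by fact
  have "prod.swap e \<in> parcs G"
    using assms(2) arcs_symmetric by (cases e) auto
  moreover have "fst e \<in> pverts G" "snd e \<in> pverts G"
    using assms(2) in_arcsD1 in_arcsD2 by (cases e; auto)+
  ultimately show ?thesis
    using assms(2)
    by (cases e) (auto simp: k_subdivision_def subdivision_path_def del_edge_def symcl_def
        image_iff map_prod_def)
qed

lemma phi_tilde_k_subdivision_0:
  assumes "pair_graph G" "e \<in> parcs G"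
  shows "phi_tilde (k_subdivision G e 0) = phi_tilde G"
proof -
  interpret pair_graph G by fact
  let ?G0 = "k_subdivision G e 0 :: ('a + nat) pair_pre_digraph"
  obtain vs where vs: "distinct vs" "set vs = pverts G"
    using finite_distinct_list[OF pair_finite_verts] by blast
  have G0: "?G0 = \<lparr>pverts = Inl ` pverts G, parcs = map_prod Inl Inl ` parcs G\<rparr>"
    by (rule k_subdivision_0[OF assms])
  have "graph_char_poly ?G0 = char_poly (adjacency_matrix (map Inl vs) ?G0)"
    by (rule graph_char_poly_eq) (use vs G0 in \<open>auto simp: distinct_map\<close>)
  also have "adjacency_matrix (map Inl vs) ?G0 = adjacency_matrix vs G"
    by (rule eq_matI) (auto simp: adjacency_matrix_def G0)
  also have "char_poly \<dots> = graph_char_poly G"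
    using graph_char_poly_eq[OF vs] by simp
  finally have 1: "graph_char_poly ?G0 = graph_char_poly G" .
  have 2: "card (pverts ?G0) = card (pverts G)"
    using G0 by (simp add: card_image)
  show ?thesis by (simp add: phi_tilde_def phi_coeff_def 1 2)
qed

end

theory Submission imports Defs begin

text \<open>
  Splitting a cut edge uv separates the graph into a part P containing u and a part containing v, and
  the determinant of two diagonal blocks joined by a single edge expands as
  \<open>\<phi>(A) \<phi>(B) - \<phi>(A - u) \<phi>(B - v)\<close>. Attaching the new path to P one vertex at a time shows that
  \<open>\<phi>(G(k)) = x \<phi>(G(k-1)) - \<phi>(G(k-2))\<close>.

  If the graph is bipartite, conjugating by the diagonal matrix with entries 1 and \<open>\<i>\<close> turns
  \<open>- \<i> A\<close> into a real skew-symmetric matrix S. The characteristic polynomial of S has nonnegative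
  coefficients: by induction through its derivative for the positive degrees, and for the constant
  term because S has no positive eigenvalue. So the polynomial with the absolute coefficients is
  \<open>\<i>\<^sup>-\<^sup>n \<phi>(\<i> x)\<close>, and it satisfies the recurrence with a plus sign, along which
  coefficientwise inequalities propagate and can become equalities only if they all are.
\<close>

section \<open>Determinants of scaled and of block-structured matrices\<close>

text \<open>In the Leibniz expansion every permutation picks one entry from each row and each
  column, so all terms share the same product of scaling factors.\<close>

lemma det_scale_rows_cols:
  assumes M: "M \<in> carrier_mat n n"
  shows "det (mat n n (\<lambda>(i, j). d i * M $$ (i, j) * c j)) =
    (\<Prod>i<n. d i) * (\<Prod>i<n. c i) * det M"
proof -
  let ?M = "mat n n (\<lambda>(i, j). d i * M $$ (i, j) * c j)"
  have "det ?M = (\<Sum>p | p permutes {0..<n}. signof p * (\<Prod>i = 0..<n. ?M $$ (i, p i)))"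
    by (rule det_def') simp
  also have "\<dots> = (\<Sum>p | p permutes {0..<n}.
      (\<Prod>i<n. d i) * (\<Prod>i<n. c i) * (signof p * (\<Prod>i = 0..<n. M $$ (i, p i))))"
  proof (rule sum.cong[OF refl])
    fix p assume "p \<in> {p. p permutes {0..<n}}"
    then have p: "p permutes {0..<n}" by simp
    have "(\<Prod>i = 0..<n. ?M $$ (i, p i)) = (\<Prod>i = 0..<n. d i * M $$ (i, p i) * c (p i))"
      by (rule prod.cong[OF refl]) (use permutes_in_image[OF p] in auto)
    also have "\<dots> = (\<Prod>i = 0..<n. d i) * (\<Prod>i = 0..<n. M $$ (i, p i)) * (\<Prod>i = 0..<n. c (p i))"
      by (simp add: prod.distrib)
    also have "(\<Prod>i = 0..<n. c (p i)) = (\<Prod>i = 0..<n. c i)"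
      using prod.permute[OF p, of c] by (simp add: o_def)
    finally show "signof p * (\<Prod>i = 0..<n. ?M $$ (i, p i)) =
        (\<Prod>i<n. d i) * (\<Prod>i<n. c i) * (signof p * (\<Prod>i = 0..<n. M $$ (i, p i)))"
      by (simp add: lessThan_atLeast0 ac_simps)
  qed
  also have "\<dots> = (\<Prod>i<n. d i) * (\<Prod>i<n. c i) * det M"
    by (simp add: det_def'[OF M] sum_distrib_left)
  finally show ?thesis .
qed

lemma det_mat_upper_right_zero:
  fixes f :: "nat \<times> nat \<Rightarrow> 'a::idom"
  assumes "\<And>i j. i < m \<Longrightarrow> m \<le> j \<Longrightarrow> j < m + k \<Longrightarrow> f (i, j) = 0"
  shows "det (mat (m + k) (m + k) f) =
    det (mat m m f) * det (mat k k (\<lambda>(i, j). f (m + i, m + j)))"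
proof -
  have "mat (m + k) (m + k) f = four_block_mat (mat m m f) (0\<^sub>m m k)
      (mat k m (\<lambda>(i, j). f (m + i, j))) (mat k k (\<lambda>(i, j). f (m + i, m + j)))"
    by (rule eq_matI) (auto simp: assms)
  then show ?thesis
    using det_four_block_mat_upper_right_zero[of "mat m m f" m "0\<^sub>m m k" k] by auto
qed

lemma det_mat_lower_left_zero:
  fixes f :: "nat \<times> nat \<Rightarrow> 'a::idom"
  assumes "\<And>i j. m \<le> i \<Longrightarrow> i < m + k \<Longrightarrow> j < m \<Longrightarrow> f (i, j) = 0"
  shows "det (mat (m + k) (m + k) f) =
    det (mat m m f) * det (mat k k (\<lambda>(i, j). f (m + i, m + j)))"
proof -
  have "mat (m + k) (m + k) f = four_block_mat (mat m m f) (mat m k (\<lambda>(i, j). f (i, m + j)))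
      (0\<^sub>m k m) (mat k k (\<lambda>(i, j). f (m + i, m + j)))"
    by (rule eq_matI) (auto simp: assms)
  then show ?thesis
    using det_four_block_mat_lower_left_zero[of "mat m m f" m _ k "0\<^sub>m k m"] by auto
qed

text \<open>Laplace expansion along row \<open>p\<close>: the columns up to \<open>p\<close> add up
  to the product of the two diagonal blocks, column \<open>Suc p\<close> contributes the correction
  term, and the remaining entries of the row are zero.\<close>

lemma det_mat_bridge:
  fixes f :: "nat \<times> nat \<Rightarrow> 'a::idom"
  assumes ur: "\<And>i j. i \<le> p \<Longrightarrow> p < j \<Longrightarrow> j < p + q + 2 \<Longrightarrow> (i, j) \<noteq> (p, Suc p) \<Longrightarrow> f (i, j) = 0"
    and ll: "\<And>i j. i \<le> p \<Longrightarrow> p < j \<Longrightarrow> j < p + q + 2 \<Longrightarrow> (i, j) \<noteq> (p, Suc p) \<Longrightarrow> f (j, i) = 0"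
  shows "det (mat (p + q + 2) (p + q + 2) f) =
    det (mat (Suc p) (Suc p) f) * det (mat (Suc q) (Suc q) (\<lambda>(i, j). f (Suc p + i, Suc p + j)))
    - f (p, Suc p) * f (Suc p, p) *
      (det (mat p p f) * det (mat q q (\<lambda>(i, j). f (p + 2 + i, p + 2 + j))))"
proof -
  define M where "M = mat (p + q + 2) (p + q + 2) f"
  define P where "P = mat (Suc p) (Suc p) f"
  define Q where "Q = mat (Suc q) (Suc q) (\<lambda>(i, j). f (Suc p + i, Suc p + j))"
  \<comment> \<open>Once row \<open>p\<close> is deleted, the upper right block vanishes and the
    minor is block triangular with the full lower block \<open>Q\<close>.\<close>
  have left: "cofactor M p j = cofactor P p j * det Q" if j: "j \<le> p" for j
  proof -
    let ?g = "\<lambda>(i, l). f (if i < p then i else Suc i, if l < j then l else Suc l)"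
    have "mat_delete M p j = mat (p + Suc q) (p + Suc q) ?g"
      by (rule eq_matI) (auto simp: mat_delete_def M_def)
    moreover have "det (mat (p + Suc q) (p + Suc q) ?g) =
        det (mat p p ?g) * det (mat (Suc q) (Suc q) (\<lambda>(i, l). ?g (p + i, p + l)))"
      by (rule det_mat_upper_right_zero) (use j ur in auto)
    moreover have "mat p p ?g = mat_delete P p j"
      by (rule eq_matI) (auto simp: mat_delete_def P_def)
    moreover have "mat (Suc q) (Suc q) (\<lambda>(i, l). ?g (p + i, p + l)) = Q"
      unfolding Q_def by (rule cong_mat) (use j in auto)
    ultimately show ?thesis by (simp only: cofactor_def mult.assoc)
  qed
  have right: "cofactor M p (Suc p) =
    - (f (Suc p, p) * (det (mat p p f) * det (mat q q (\<lambda>(i, j). f (p + 2 + i, p + 2 + j)))))"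
  proof -
    let ?g = "\<lambda>(i, l). f (if i < p then i else Suc i, if l < Suc p then l else Suc l)"
    let ?h = "\<lambda>(i, l). ?g (p + i, p + l)"
    have "mat_delete M p (Suc p) = mat (p + Suc q) (p + Suc q) ?g"
      by (rule eq_matI) (auto simp: mat_delete_def M_def)
    moreover have "det (mat (p + Suc q) (p + Suc q) ?g) = det (mat p p ?g) * det (mat (Suc q) (Suc q) ?h)"
      by (rule det_mat_lower_left_zero) (use ll in auto)
    \<comment> \<open>The first column of this block is the old column \<open>p\<close>, which below
      row \<open>p\<close> vanishes except for the bridge entry \<open>f (Suc p, p)\<close>; hence
      the further split into sizes 1 and \<open>q\<close>.\<close>
    moreover have "det (mat (1 + q) (1 + q) ?h) =
        det (mat 1 1 ?h) * det (mat q q (\<lambda>(i, l). ?h (1 + i, 1 + l)))"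
      by (rule det_mat_lower_left_zero) (use ll in auto)
    moreover have "det (mat 1 1 ?h) = f (Suc p, p)"
      by (subst det_single) auto
    moreover have "mat p p ?g = mat p p f"
      by (rule cong_mat) auto
    moreover have "mat q q (\<lambda>(i, l). ?h (1 + i, 1 + l)) = mat q q (\<lambda>(i, j). f (p + 2 + i, p + 2 + j))"
      by (rule cong_mat) auto
    moreover have "(- 1) ^ (p + Suc p) = (- 1 :: 'a)"
      by (simp flip: mult_2)
    ultimately show ?thesis by (simp only: cofactor_def plus_1_eq_Suc mult_minus1 mult.left_commute)
  qed
  have "det M = (\<Sum>j<p + q + 2. M $$ (p, j) * cofactor M p j)"
    by (rule laplace_expansion_row) (auto simp: M_def)
  also have "\<dots> = (\<Sum>j<Suc (Suc p). M $$ (p, j) * cofactor M p j)"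
    by (rule sum.mono_neutral_right) (auto simp: M_def ur)
  also have "\<dots> = (\<Sum>j<Suc p. P $$ (p, j) * cofactor P p j) * det Q
      + f (p, Suc p) * cofactor M p (Suc p)"
  proof -
    have "(\<Sum>j<Suc p. M $$ (p, j) * cofactor M p j)
        = (\<Sum>j<Suc p. P $$ (p, j) * cofactor P p j) * det Q"
      unfolding sum_distrib_right
    proof (rule sum.cong[OF refl])
      fix j assume "j \<in> {..<Suc p}"
      moreover from this have "M $$ (p, j) = P $$ (p, j)"
        by (simp add: M_def P_def)
      ultimately show "M $$ (p, j) * cofactor M p j = P $$ (p, j) * cofactor P p j * det Q"
        by (simp add: left)
    qed
    moreover have "M $$ (p, Suc p) = f (p, Suc p)"
      by (simp add: M_def)
    ultimately show ?thesis by simp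
  qed
  also have "(\<Sum>j<Suc p. P $$ (p, j) * cofactor P p j) = det P"
    by (rule laplace_expansion_row[symmetric]) (auto simp: P_def)
  finally show ?thesis
    unfolding right by (simp add: M_def P_def Q_def algebra_simps)
qed

section \<open>Real skew-symmetric matrices\<close>

text \<open>The derivative of the characteristic polynomial is the sum of those of the principal
  submatrices with one index deleted, which are again skew-symmetric; this settles the positive
  degrees. A negative constant term would force a positive root.\<close>

lemma char_poly_skew_symmetric_coeff_nonneg:
  fixes A :: "real mat"
  assumes "A \<in> carrier_mat n n" and "transpose_mat A = - A"
  shows "0 \<le> coeff (char_poly A) j"
  using assms
proof (induction n arbitrary: A j)
  case 0
  then show ?case
    by (simp add: char_poly_def char_poly_matrix_def coeff_1)
next
  case (Suc n)
  note A = Suc.prems(1)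
  have skew: "A $$ (l, k) = - A $$ (k, l)" if "k < Suc n" "l < Suc n" for k l
  proof -
    have "transpose_mat A $$ (k, l) = (- A) $$ (k, l)"
      by (simp only: Suc.prems(2))
    then show ?thesis
      using that carrier_matD[OF A] by simp
  qed
  have del: "0 \<le> coeff (char_poly (mat_delete A i i)) l" if "i < Suc n" for i l
  proof (rule Suc.IH)
    show "mat_delete A i i \<in> carrier_mat n n"
      using mat_delete_carrier[OF A] by simp
    show "transpose_mat (mat_delete A i i) = - mat_delete A i i"
    proof (rule eq_matI)
      fix k l assume kl: "k < dim_row (- mat_delete A i i)" "l < dim_col (- mat_delete A i i)"
      define s where "s r = (if r < i then r else Suc r)" for r
      have entry: "mat_delete A i i $$ (k', l') = A $$ (s k', s l')" if "k' < n" "l' < n" for k' l'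
        using A that by (simp add: mat_delete_def s_def)
      show "transpose_mat (mat_delete A i i) $$ (k, l) = (- mat_delete A i i) $$ (k, l)"
        using kl A skew[of "s k" "s l"] by (simp add: entry) (simp add: s_def)
    qed (use A in auto)
  qed
  show ?case
  proof (cases j)
    case (Suc l)
    have "real (Suc l) * coeff (char_poly A) (Suc l) = coeff (pderiv (char_poly A)) l"
      by (simp add: coeff_pderiv)
    also have "\<dots> \<ge> 0"
      unfolding pderiv_char_poly[OF A] coeff_sum by (rule sum_nonneg) (use del in auto)
    finally show ?thesis
      using Suc by (simp add: zero_le_mult_iff)
  next
    case 0
    have no_root: "poly (char_poly A) t \<noteq> 0" if "t > 0" for t
    proof
      assume "poly (char_poly A) t = 0"
      then obtain v where v: "v \<in> carrier_vec (Suc n)" "v \<noteq> 0\<^sub>v (Suc n)" and Av: "A *\<^sub>v v = t \<cdot>\<^sub>v v"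
        using eigenvalue_root_char_poly[OF A] A by (auto simp: eigenvalue_def eigenvector_def)
      \<comment> \<open>Moving \<open>A\<close> across the scalar product costs a sign, so
        \<open>t * (v \<bullet> v)\<close> equals its own negative.\<close>
      have "t * (v \<bullet> v) = (A *\<^sub>v v) \<bullet> v"
        using v by (simp add: Av)
      also have "\<dots> = v \<bullet> (transpose_mat A *\<^sub>v v)"
        using transpose_vec_mult_scalar[OF A v(1) v(1)]
        by (metis A Av comm_scalar_prod mult_mat_vec_carrier transpose_carrier_mat v(1))
      also have "\<dots> = - (t * (v \<bullet> v))"
        using A v by (simp add: Suc.prems(2) Av uminus_mult_mat_vec)
      finally have "v \<bullet> v = 0" using that by simp
      then show False
        using conjugate_square_eq_0_vec[OF v(1)] v(2) by simp
    qed
    have "0 \<le> poly (char_poly A) 0"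
    proof (rule ccontr)
      assume neg: "\<not> 0 \<le> poly (char_poly A) 0"
      have "lead_coeff (char_poly A) > 0"
        using degree_monic_char_poly[OF A] by simp
      from poly_pinfty_gt_lc[OF this] obtain b where "\<forall>x\<ge>b. lead_coeff (char_poly A) \<le> poly (char_poly A) x"
        by blast
      \<comment> \<open>The endpoint \<open>max b 1\<close> is positive whatever \<open>b\<close>
        is, so the intermediate value theorem applies on the interval from 0.\<close>
      then have "0 < poly (char_poly A) (max b 1)"
        using \<open>lead_coeff (char_poly A) > 0\<close> by (meson max.cobounded1 less_le_trans)
      then obtain t where "0 < t" "poly (char_poly A) t = 0"
        using poly_IVT_pos[of 0 "max b 1" "char_poly A"] neg by (auto simp: less_max_iff_disj)
      then show False using no_root by simp
    qed
    then show ?thesis using 0 by (simp add: poly_0_coeff_0)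
  qed
qed

section \<open>Adjacency matrices and bridges\<close>

text \<open>These are the entries of \<open>xI - A\<close>, as a function on index pairs so that
  \<open>det_mat_bridge\<close> applies directly.\<close>

definition adjacency_entry :: "'a list \<Rightarrow> 'a pair_pre_digraph \<Rightarrow> nat \<times> nat \<Rightarrow> int poly" where
  "adjacency_entry vs G = (\<lambda>(i, j).
     (if i = j then [:0, 1:] else 0) - (if (vs ! i, vs ! j) \<in> parcs G then 1 else 0))"

lemma char_poly_adjacency_matrix:
  "char_poly (adjacency_matrix vs G) =
    det (mat (length vs) (length vs) (adjacency_entry vs G))"
  unfolding char_poly_def
  by (rule arg_cong[of _ _ det], rule eq_matI)
    (auto simp: char_poly_matrix_def adjacency_matrix_def adjacency_entry_def one_pCons)

text \<open>Listing the ends of the bridge at adjacent positions gives \<open>xI - A\<close> the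
  shape of \<open>det_mat_bridge\<close>. Both bridge entries are -1, so their product is 1.\<close>

lemma char_poly_adjacency_matrix_bridge:
  assumes a: "a \<notin> set us" and b: "b \<notin> set ws"
    and to: "\<And>x y. x \<in> set (us @ [a]) \<Longrightarrow> y \<in> set (b # ws) \<Longrightarrow>
      (x, y) \<in> parcs G \<longleftrightarrow> x = a \<and> y = b"
    and fro: "\<And>x y. x \<in> set (us @ [a]) \<Longrightarrow> y \<in> set (b # ws) \<Longrightarrow>
      (y, x) \<in> parcs G \<longleftrightarrow> x = a \<and> y = b"
  shows "char_poly (adjacency_matrix (us @ a # b # ws) G) =
    char_poly (adjacency_matrix (us @ [a]) G) * char_poly (adjacency_matrix (b # ws) G)
    - char_poly (adjacency_matrix us G) * char_poly (adjacency_matrix ws G)"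
proof -
  define p where "p = length us"
  define q where "q = length ws"
  define vs where "vs = us @ a # b # ws"
  let ?f = "adjacency_entry vs G"
  have left: "vs ! i \<in> set (us @ [a])" "vs ! i = a \<longleftrightarrow> i = p" if "i \<le> p" for i
    using that a by (auto simp: vs_def p_def nth_append)
  have right: "vs ! j \<in> set (b # ws)" "vs ! j = b \<longleftrightarrow> j = Suc p" if "p < j" "j < p + q + 2" for j
  proof -
    define l where "l = j - Suc p"
    then have l: "j = Suc p + l" using that by simp
    then have nth: "vs ! j = (b # ws) ! l" "l < length (b # ws)"
      using that by (auto simp: vs_def p_def q_def nth_append)
    then show "vs ! j \<in> set (b # ws)"
      by (metis nth_mem)
    show "vs ! j = b \<longleftrightarrow> j = Suc p"
      using b l nth by (cases l) (auto dest: nth_mem)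
  qed
  have "det (mat (p + q + 2) (p + q + 2) ?f) =
    det (mat (Suc p) (Suc p) ?f) * det (mat (Suc q) (Suc q) (\<lambda>(i, j). ?f (Suc p + i, Suc p + j)))
    - ?f (p, Suc p) * ?f (Suc p, p) *
      (det (mat p p ?f) * det (mat q q (\<lambda>(i, j). ?f (p + 2 + i, p + 2 + j))))"
  proof (rule det_mat_bridge)
    fix i j assume ij: "i \<le> p" "p < j" "j < p + q + 2" "(i, j) \<noteq> (p, Suc p)"
    then have "i \<noteq> j" "vs ! i \<noteq> a \<or> vs ! j \<noteq> b"
      using left(2)[of i] right(2)[of j] by auto
    then show "?f (i, j) = 0" "?f (j, i) = 0"
      using to[OF left(1)[OF ij(1)] right(1)[OF ij(2,3)]]
        fro[OF left(1)[OF ij(1)] right(1)[OF ij(2,3)]]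
      by (auto simp: adjacency_entry_def)
  qed
  moreover have "mat (Suc p) (Suc p) ?f = mat (Suc p) (Suc p) (adjacency_entry (us @ [a]) G)"
    by (rule cong_mat) (auto simp: adjacency_entry_def vs_def p_def nth_append less_Suc_eq)
  moreover have "mat p p ?f = mat p p (adjacency_entry us G)"
    by (rule cong_mat) (auto simp: adjacency_entry_def vs_def p_def nth_append)
  moreover have "mat (Suc q) (Suc q) (\<lambda>(i, j). ?f (Suc p + i, Suc p + j)) =
      mat (Suc q) (Suc q) (adjacency_entry (b # ws) G)"
    by (rule cong_mat) (auto simp: adjacency_entry_def vs_def p_def nth_append)
  moreover have "mat q q (\<lambda>(i, j). ?f (p + 2 + i, p + 2 + j)) = mat q q (adjacency_entry ws G)"
    by (rule cong_mat) (auto simp: adjacency_entry_def vs_def p_def nth_append)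
  moreover have "?f (p, Suc p) = - 1" "?f (Suc p, p) = - 1"
    using to[of a b] fro[of a b] by (auto simp: adjacency_entry_def vs_def p_def nth_append)
  moreover have "length vs = p + q + 2"
    by (simp add: vs_def p_def q_def)
  ultimately show ?thesis
    unfolding char_poly_adjacency_matrix
    by (simp only: vs_def[symmetric] length_append_singleton length_Cons p_def[symmetric]
        q_def[symmetric] mult_minus1 minus_minus mult_1)
qed

text \<open>Only arcs between listed vertices matter, so induced subgraphs can be compared, such as
  one side of a cut edge before and after subdivision.\<close>

lemma char_poly_adjacency_matrix_map:
  assumes "\<And>x y. x \<in> set vs \<Longrightarrow> y \<in> set vs \<Longrightarrow>
    (h x, h y) \<in> parcs H \<longleftrightarrow> (x, y) \<in> parcs G"
  shows "char_poly (adjacency_matrix (map h vs) H) = char_poly (adjacency_matrix vs G)"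
  by (rule arg_cong[of _ _ char_poly], rule eq_matI) (auto simp: adjacency_matrix_def assms)

lemma char_poly_adjacency_matrix_Nil: "char_poly (adjacency_matrix [] G) = 1"
  by (simp add: char_poly_adjacency_matrix)

lemma char_poly_adjacency_matrix_single:
  "(x, x) \<notin> parcs G \<Longrightarrow> char_poly (adjacency_matrix [x] G) = [:0, 1:]"
  unfolding char_poly_adjacency_matrix
  by (subst det_single) (auto simp: adjacency_entry_def)

section \<open>Structure of subdivision graphs and of cut edges\<close>

lemma vwalk_arcs_snoc: "p \<noteq> [] \<Longrightarrow> vwalk_arcs (p @ [y]) = vwalk_arcs p @ [(last p, y)]"
  by (induction p rule: vwalk_arcs.induct) auto

lemma set_vwalk_arcs_subdivision_path:
  "set (vwalk_arcs (subdivision_path (u, v) k)) =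
    (if k = 0 then {(Inl u, Inl v)}
     else {(Inl u, Inr 0), (Inr (k - 1), Inl v)} \<union> {(Inr i, Inr (Suc i)) | i. Suc i < k})"
proof (cases k)
  case 0
  then show ?thesis by (simp add: subdivision_path_def)
next
  case (Suc m)
  \<comment> \<open>This is the path without its end \<open>v\<close>; its last vertex is
    \<open>Inr m\<close>, and it grows by one new vertex per step of the induction.\<close>
  let ?p = "\<lambda>m. Inl u # map Inr [0..<Suc m] :: ('a + nat) list"
  have last: "last (?p m) = Inr m" for m
    by simp
  have "set (vwalk_arcs (?p m)) = insert (Inl u, Inr 0) {(Inr i, Inr (Suc i)) | i. i < m}"
  proof (induction m)
    case (Suc m)
    have "?p (Suc m) = ?p m @ [Inr (Suc m)]" by simp
    then have "vwalk_arcs (?p (Suc m)) = vwalk_arcs (?p m) @ [(Inr m, Inr (Suc m))]"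
      by (simp only: vwalk_arcs_snoc last list.distinct not_False_eq_True)
    then have "set (vwalk_arcs (?p (Suc m))) = insert (Inr m, Inr (Suc m)) (set (vwalk_arcs (?p m)))"
      by (simp only: set_append list.set) simp
    then show ?case by (simp only: Suc.IH) (auto simp: less_Suc_eq)
  qed simp
  moreover have "vwalk_arcs (?p m @ [Inl v]) = vwalk_arcs (?p m) @ [(Inr m, Inl v)]"
    by (simp only: vwalk_arcs_snoc last list.distinct not_False_eq_True)
  moreover have "subdivision_path (u, v) k = ?p m @ [Inl v]"
    by (simp add: subdivision_path_def Suc)
  ultimately have "set (vwalk_arcs (subdivision_path (u, v) k)) =
      insert (Inr m, Inl v) (insert (Inl u, Inr 0) {(Inr i, Inr (Suc i)) | i. i < m})"
    by (simp only: set_append list.set) blast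
  then show ?thesis by (auto simp: Suc)
qed

text \<open>For \<open>k = 0\<close> the path is the edge itself, so the removed arcs come back
  exactly then. For \<open>k = 1\<close> the single new vertex is adjacent to both \<open>u\<close>
  and \<open>v\<close>.\<close>

lemma parcs_k_subdivision:
  assumes "(u, v) \<in> parcs G" "(v, u) \<in> parcs G"
  shows "(Inl a, Inl b) \<in> parcs (k_subdivision G (u, v) k) \<longleftrightarrow>
      (a, b) \<in> parcs G \<and> (k = 0 \<or> (a, b) \<noteq> (u, v) \<and> (a, b) \<noteq> (v, u))"
    and "(Inl a, Inr j) \<in> parcs (k_subdivision G (u, v) k) \<longleftrightarrow>
      j < k \<and> (a = u \<and> j = 0 \<or> a = v \<and> Suc j = k)"
    and "(Inr j, Inl a) \<in> parcs (k_subdivision G (u, v) k) \<longleftrightarrow>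
      j < k \<and> (a = u \<and> j = 0 \<or> a = v \<and> Suc j = k)"
    and "(Inr i, Inr j) \<in> parcs (k_subdivision G (u, v) k) \<longleftrightarrow>
      i < k \<and> j < k \<and> (j = Suc i \<or> i = Suc j)"
proof -
  have "(Inl a, Inl b) \<in> map_prod Inl Inl ` S \<longleftrightarrow> (a, b) \<in> S" for S
    by force
  note defs = this k_subdivision_def set_vwalk_arcs_subdivision_path symcl_def del_edge_def
  show "(Inl a, Inl b) \<in> parcs (k_subdivision G (u, v) k) \<longleftrightarrow>
      (a, b) \<in> parcs G \<and> (k = 0 \<or> (a, b) \<noteq> (u, v) \<and> (a, b) \<noteq> (v, u))"
    using assms by (auto simp: defs)
qed (auto simp: k_subdivision_def set_vwalk_arcs_subdivision_path symcl_def)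

lemma pverts_k_subdivision:
  assumes "u \<in> pverts G" "v \<in> pverts G"
  shows "pverts (k_subdivision G (u, v) k) = Inl ` pverts G \<union> Inr ` {..<k}"
  using assms by (auto simp: k_subdivision_def subdivision_path_def)

text \<open>Take for \<open>P\<close> the vertices reachable from \<open>u\<close> once the edge is
  deleted. No remaining arc enters or leaves \<open>P\<close>, so only the deleted arcs can
  cross.\<close>

lemma cut_edge_separates:
  assumes "pair_graph G" and "cut_edge G (u, v)"
  obtains P where "u \<in> P" "v \<notin> P" "P \<subseteq> pverts G"
    "\<And>x y. (x, y) \<in> parcs G \<Longrightarrow> x \<in> P \<Longrightarrow> y \<notin> P \<Longrightarrow> x = u \<and> y = v"
    "\<And>x y. (x, y) \<in> parcs G \<Longrightarrow> x \<notin> P \<Longrightarrow> y \<in> P \<Longrightarrow> x = v \<and> y = u"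
proof -
  interpret pair_graph G by fact
  define D where "D = del_edge G (u, v)"
  have pD: "pverts D = pverts G" "parcs D = parcs G - {(u, v), (v, u)}"
    by (auto simp: D_def del_edge_def)
  interpret D: pair_wf_digraph D
    by unfold_locales (use pD arc_fst_in_verts arc_snd_in_verts in auto)
  have symD: "symmetric (with_proj D)"
    using arcs_symmetric by (auto simp: symmetric_def sym_def pD)
  have uv: "(u, v) \<in> parcs G" "u \<in> pverts G" "v \<in> pverts G"
    using assms(2) in_arcsD1 in_arcsD2 by (auto simp: cut_edge_def)
  define P where "P = {w. u \<rightarrow>\<^sup>*\<^bsub>with_proj D\<^esub> w}"
  have arcD: "x \<in> P \<longleftrightarrow> y \<in> P" if "(x, y) \<in> parcs D" for x y
    using that symD D.reachable_adj_trans[of u x y] D.reachable_adj_trans[of u y x]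
    by (auto simp: P_def symmetric_def sym_def)
  \<comment> \<open>If \<open>v\<close> stayed reachable, every use of the deleted edge could be
    rerouted; reachability and hence the components would be those of \<open>G\<close>, against the
    choice of a cut edge.\<close>
  have vP: "v \<notin> P"
  proof
    assume "v \<in> P"
    then have reach: "u \<rightarrow>\<^sup>*\<^bsub>with_proj D\<^esub> v" "v \<rightarrow>\<^sup>*\<^bsub>with_proj D\<^esub> u"
      using symmetric_reachable[OF symD] by (auto simp: P_def)
    have "x \<rightarrow>\<^sup>*\<^bsub>with_proj D\<^esub> y \<longleftrightarrow> x \<rightarrow>\<^sup>*\<^bsub>with_proj G\<^esub> y" for x y
    proof
      assume "x \<rightarrow>\<^sup>*\<^bsub>with_proj D\<^esub> y"
      then show "x \<rightarrow>\<^sup>*\<^bsub>with_proj G\<^esub> y"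
        by (induction rule: D.reachable_induct) (auto simp: pD intro: reachable_adj_trans)
    next
      assume "x \<rightarrow>\<^sup>*\<^bsub>with_proj G\<^esub> y"
      then show "x \<rightarrow>\<^sup>*\<^bsub>with_proj D\<^esub> y"
      proof (induction rule: reachable_induct)
        case base
        then show ?case using D.reachable_refl pD by auto
      next
        case (step y z)
        then have "y \<rightarrow>\<^sup>*\<^bsub>with_proj D\<^esub> z"
          using reach D.reachable_adjI[of y z] by (cases "(y, z) \<in> parcs D") (auto simp: pD)
        then show ?case using step D.reachable_trans by blast
      qed
    qed
    then have "pre_digraph.sccs_verts (with_proj D) = pre_digraph.sccs_verts (with_proj G)"
      unfolding pre_digraph.sccs_verts_def by simp
    then show False using assms(2) by (simp add: cut_edge_def D_def)
  qed
  show thesis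
  proof (rule that)
    show "u \<in> P" using uv D.reachable_refl pD by (auto simp: P_def)
    show "P \<subseteq> pverts G"
      using pD by (auto simp: P_def elim: reachable_in_vertsE)
    then show "x = u \<and> y = v" if "(x, y) \<in> parcs G" "x \<in> P" "y \<notin> P" for x y
      using arcD[of x y] that vP by (auto simp: pD)
    show "x = v \<and> y = u" if "(x, y) \<in> parcs G" "x \<notin> P" "y \<in> P" for x y
      using arcD[of x y] that vP \<open>u \<in> P\<close> by (auto simp: pD)
  qed (fact vP)
qed

section \<open>Signs of the coefficients for bipartite graphs\<close>

lemma poly_char_poly:
  fixes A :: "'a::field mat"
  assumes "A \<in> carrier_mat n n"
  shows "poly (char_poly A) x = det (x \<cdot>\<^sub>m 1\<^sub>m n - A)"
  unfolding char_poly_matrix[OF assms]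
  by (rule arg_cong[of _ _ det], rule eq_matI) (use assms in \<open>auto simp: char_matrix_def\<close>)

text \<open>Scaling rows by \<open>d\<close> and columns by \<open>c = 1 / d\<close> turns
  \<open>\<i>xI - A\<close> into \<open>\<i>(xI - S)\<close>, where \<open>S\<close> is the
  adjacency matrix signed by the colours and is skew-symmetric. Hence
  \<open>p(\<i>x) = \<i>^n q(x)\<close> with nonnegative coefficients in \<open>q\<close>. Keeping
  the sign as a power of \<open>\<i>\<close> avoids a case distinction on parities.\<close>

lemma char_poly_bipartite_adjacency_coeff:
  assumes sym: "\<And>x y. (x, y) \<in> parcs G \<Longrightarrow> (y, x) \<in> parcs G"
    and colour: "\<And>x y. (x, y) \<in> parcs G \<Longrightarrow> side x \<noteq> (side y :: bool)"
  obtains s :: real where "0 \<le> s"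
    "of_int (coeff (char_poly (adjacency_matrix vs G)) j) * \<i> ^ j = \<i> ^ length vs * complex_of_real s"
proof -
  define n where "n = length vs"
  define A where "A = adjacency_matrix vs G"
  define AC :: "complex mat" where "AC = map_mat of_int A"
  define S :: "real mat" where "S = mat n n (\<lambda>(i, j).
    if (vs ! i, vs ! j) \<in> parcs G then if side (vs ! i) then 1 else - 1 else 0)"
  define SC :: "complex mat" where "SC = map_mat of_real S"
  define d where "d i = (if side (vs ! i) then 1 else - \<i>)" for i
  define c where "c i = (if side (vs ! i) then 1 else \<i>)" for i
  have carrier: "A \<in> carrier_mat n n" "AC \<in> carrier_mat n n" "S \<in> carrier_mat n n" "SC \<in> carrier_mat n n"
    by (auto simp: A_def AC_def S_def SC_def n_def)
  define p where "p = map_poly complex_of_int (char_poly A)"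
  define q where "q = map_poly complex_of_real (char_poly S)"
  have p: "p = char_poly AC"
    unfolding p_def AC_def by (rule of_int_hom.char_poly_hom[OF carrier(1), symmetric])
  have q: "q = char_poly SC"
    unfolding q_def SC_def by (rule of_real_hom.char_poly_hom[OF carrier(3), symmetric])
  have "poly (p \<circ>\<^sub>p [:0, \<i>:]) x = poly (Polynomial.smult (\<i> ^ n) q) x" for x
  proof -
    let ?M = "(\<i> * x) \<cdot>\<^sub>m 1\<^sub>m n - AC"
    let ?N = "x \<cdot>\<^sub>m 1\<^sub>m n - SC"
    have M: "?M \<in> carrier_mat n n" and N: "?N \<in> carrier_mat n n"
      using carrier by auto
    \<comment> \<open>The colouring enters here: on an arc \<open>d i * c j\<close> is plus or minus
      \<open>\<i>\<close>, and the diagonal of the adjacency matrix is zero.\<close>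
    have "mat n n (\<lambda>(i, j). d i * ?M $$ (i, j) * c j) = \<i> \<cdot>\<^sub>m ?N"
      by (rule eq_matI)
        (use carrier in \<open>auto simp: d_def c_def AC_def SC_def A_def S_def adjacency_matrix_def n_def
          dest: colour\<close>)
    then have "det (\<i> \<cdot>\<^sub>m ?N) = (\<Prod>i<n. d i) * (\<Prod>i<n. c i) * det ?M"
      using det_scale_rows_cols[OF M, of d c] by simp
    also have "(\<Prod>i<n. d i) * (\<Prod>i<n. c i) = 1"
      unfolding prod.distrib[symmetric] by (rule prod.neutral) (auto simp: d_def c_def)
    finally have "det ?M = \<i> ^ n * det ?N"
      using carrier(4) by simp
    then show ?thesis
      by (simp add: p q poly_pcompose poly_char_poly[OF carrier(2)] poly_char_poly[OF carrier(4)] mult.commute)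
  qed
  then have "p \<circ>\<^sub>p [:0, \<i>:] = Polynomial.smult (\<i> ^ n) q"
    by (simp add: poly_eq_poly_eq_iff[symmetric] fun_eq_iff)
  then have "coeff (p \<circ>\<^sub>p [:0, \<i>:]) j = coeff (Polynomial.smult (\<i> ^ n) q) j"
    by simp
  then have "of_int (coeff (char_poly A) j) * \<i> ^ j = \<i> ^ n * complex_of_real (coeff (char_poly S) j)"
    by (simp add: coeff_pcompose_linear p_def q_def coeff_map_poly mult.commute)
  moreover have "0 \<le> coeff (char_poly S) j"
  proof (rule char_poly_skew_symmetric_coeff_nonneg[OF carrier(3)])
    show "transpose_mat S = - S"
      by (rule eq_matI) (auto simp: S_def dest: sym colour)
  qed
  ultimately show thesis
    using that by (simp add: A_def n_def)
qed

text \<open>Reversing the summation index undoes the numbering by \<open>n - i\<close>; above the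
  order both sides vanish, because the degree equals the order.\<close>

lemma coeff_phi_tilde:
  assumes "finite (pverts G)"
  shows "coeff (phi_tilde G) j = \<bar>coeff (graph_char_poly G) j\<bar>"
proof -
  obtain vs where vs: "distinct vs" "set vs = pverts G"
    using finite_distinct_list[OF assms] by blast
  let ?n = "card (pverts G)"
  have deg: "degree (graph_char_poly G) = ?n"
    using degree_monic_char_poly[OF adjacency_matrix_carrier[of vs G]] vs distinct_card[OF vs(1)]
    by (simp add: graph_char_poly_eq[OF vs])
  have "phi_tilde G = (\<Sum>i\<le>?n. monom \<bar>coeff (graph_char_poly G) i\<bar> i)"
    unfolding phi_tilde_def phi_coeff_def atLeast0AtMost
    by (rule sum.reindex_bij_witness[of _ "\<lambda>i. ?n - i" "\<lambda>i. ?n - i"]) auto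
  then have "coeff (phi_tilde G) j = (\<Sum>i\<le>?n. if i = j then \<bar>coeff (graph_char_poly G) i\<bar> else 0)"
    by (simp add: coeff_sum)
  also have "\<dots> = \<bar>coeff (graph_char_poly G) j\<bar>"
    using deg by (auto simp: coeff_eq_0)
  finally show ?thesis .
qed

text \<open>Powers of \<open>\<i>\<close> have norm 1, so comparing norms identifies the nonnegative
  real \<open>s\<close> with the absolute value of the coefficient.\<close>

lemma coeff_phi_tilde_bipartite:
  assumes fin: "finite (pverts G)"
    and sym: "\<And>x y. (x, y) \<in> parcs G \<Longrightarrow> (y, x) \<in> parcs G"
    and colour: "\<And>x y. (x, y) \<in> parcs G \<Longrightarrow> side x \<noteq> (side y :: bool)"
  shows "of_int (coeff (graph_char_poly G) j) * \<i> ^ j =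
    \<i> ^ card (pverts G) * complex_of_int (coeff (phi_tilde G) j)"
proof -
  obtain vs where vs: "distinct vs" "set vs = pverts G"
    using finite_distinct_list[OF fin] by blast
  obtain s where s: "0 \<le> s"
    "of_int (coeff (graph_char_poly G) j) * \<i> ^ j = \<i> ^ card (pverts G) * complex_of_real s"
    using char_poly_bipartite_adjacency_coeff[of G side vs j, OF sym colour]
      distinct_card[OF vs(1)] vs(2) unfolding graph_char_poly_eq[OF vs] by metis
  then have "norm (of_int (coeff (graph_char_poly G) j) * \<i> ^ j) = norm (\<i> ^ card (pverts G) * complex_of_real s)"
    by simp
  then have "s = of_int (coeff (phi_tilde G) j)"
    using s(1) by (simp add: norm_mult norm_power coeff_phi_tilde[OF fin])
  then have "complex_of_real s = of_int (coeff (phi_tilde G) j)"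
    by (simp only: of_real_of_int_eq)
  then show ?thesis using s(2) by simp
qed

section \<open>The recurrence along the subdivision\<close>

text \<open>With \<open>p\<close> and \<open>q\<close> belonging to \<open>P - u\<close> and
  \<open>P\<close>, the value at \<open>Suc j\<close> is the characteristic polynomial of
  \<open>P\<close> with a path of \<open>j\<close> new vertices attached at
  \<open>u\<close>.\<close>

fun path_poly :: "int poly \<Rightarrow> int poly \<Rightarrow> nat \<Rightarrow> int poly" where
  "path_poly p q 0 = p"
| "path_poly p q (Suc 0) = q"
| "path_poly p q (Suc (Suc n)) = [:0, 1:] * path_poly p q (Suc n) - path_poly p q n"

text \<open>The last edge of the path is a bridge to \<open>v\<close>. The side of \<open>v\<close>,
  with and without \<open>v\<close>, yields \<open>r\<close> and \<open>s\<close> independently of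
  \<open>k\<close>; only the other side grows.\<close>

lemma graph_char_poly_k_subdivision:
  assumes pg: "pair_graph G" and cut: "cut_edge G (u, v)"
  obtains p q r s where "\<And>k. graph_char_poly (k_subdivision G (u, v) k) =
    path_poly p q (Suc k) * r - path_poly p q k * s"
proof -
  interpret pair_graph G by fact
  obtain P where P: "u \<in> P" "v \<notin> P" "P \<subseteq> pverts G"
    and cross: "\<And>x y. (x, y) \<in> parcs G \<Longrightarrow> x \<in> P \<Longrightarrow> y \<notin> P \<Longrightarrow> x = u \<and> y = v"
      "\<And>x y. (x, y) \<in> parcs G \<Longrightarrow> x \<notin> P \<Longrightarrow> y \<in> P \<Longrightarrow> x = v \<and> y = u"
    by (rule cut_edge_separates[OF pg cut]) blast
  have uv: "(u, v) \<in> parcs G" "(v, u) \<in> parcs G" "u \<in> pverts G" "v \<in> pverts G" "u \<noteq> v"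
    using cut arcs_symmetric in_arcsD1 in_arcsD2 P by (auto simp: cut_edge_def)
  have "finite (P - {u})" "finite (pverts G - P - {v})"
    using P pair_finite_verts by (auto intro: finite_subset)
  then obtain us ws where us: "distinct us" "set us = P - {u}"
    and ws: "distinct ws" "set ws = pverts G - P - {v}"
    using finite_distinct_list by metis
  define p where "p = char_poly (adjacency_matrix us G)"
  define q where "q = char_poly (adjacency_matrix (us @ [u]) G)"
  define r where "r = char_poly (adjacency_matrix (v # ws) G)"
  define s where "s = char_poly (adjacency_matrix ws G)"
  have "graph_char_poly (k_subdivision G (u, v) k) = path_poly p q (Suc k) * r - path_poly p q k * s" for k
  proof -
    let ?K = "k_subdivision G (u, v) k"
    let ?cp = "\<lambda>xs. char_poly (adjacency_matrix xs ?K)"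
    note arcs = parcs_k_subdivision[OF uv(1,2), where k = k]
    \<comment> \<open>The list \<open>init j @ [tip j]\<close> runs through \<open>P\<close> and the
      first \<open>j\<close> new vertices and ends where the path continues. At \<open>j = 0\<close>
      that end is \<open>u\<close> itself, whence the separate case.\<close>
    define init where "init j = (if j = 0 then map Inl us else map Inl (us @ [u]) @ map Inr [0..<j - 1])" for j :: nat
    define tip where "tip j = (if j = 0 then Inl u else Inr (j - 1))" for j :: nat
    have chain_Suc: "init (Suc j) = init j @ [tip j]" for j
      by (cases j) (auto simp: init_def tip_def)
    have set_chain: "set (init j @ [tip j]) = Inl ` P \<union> Inr ` {..<j}" for j
      using us P by (cases j) (auto simp: init_def tip_def less_Suc_eq)
    have tip: "tip j \<notin> set (init j)" for j
    proof (cases j)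
      case 0
      then show ?thesis using us(2) by (simp add: init_def tip_def image_iff)
    next
      case (Suc i)
      then show ?thesis by (simp add: init_def tip_def image_iff)
    qed
    \<comment> \<open>The edge \<open>uv\<close> has its ends on different sides, so the arcs within
      one side are untouched by the subdivision.\<close>
    have side: "?cp (map Inl xs) = char_poly (adjacency_matrix xs G)"
      if "set xs \<subseteq> P \<or> set xs \<inter> P = {}" for xs
      by (rule char_poly_adjacency_matrix_map) (use that P in \<open>auto simp: arcs\<close>)
    have chain: "?cp (init j @ [tip j]) = path_poly p q (Suc j) \<and> ?cp (init j) = path_poly p q j"
      if "j \<le> k" for j
      using that
    proof (induction j)
      case 0
      have "?cp (map Inl (us @ [u])) = q" "?cp (map Inl us) = p"
        unfolding p_def q_def by (rule side, use us P in auto)+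
      then show ?case by (simp add: init_def tip_def)
    next
      case (Suc j)
      \<comment> \<open>In this induced subgraph \<open>Inr j\<close> is pendant at
        \<open>tip j\<close>: a possible further neighbour \<open>v\<close> lies outside
        \<open>P\<close>, and later path vertices are not listed.\<close>
      have "?cp (init j @ tip j # Inr j # []) =
        ?cp (init j @ [tip j]) * ?cp [Inr j] - ?cp (init j) * ?cp []"
        by (rule char_poly_adjacency_matrix_bridge[OF tip], unfold set_chain)
          (use Suc.prems P in \<open>auto simp: arcs tip_def\<close>)
      then have "?cp (init (Suc j) @ [tip (Suc j)]) =
        [:0, 1:] * ?cp (init j @ [tip j]) - ?cp (init j)"
        by (simp add: chain_Suc tip_def char_poly_adjacency_matrix_Nil
            char_poly_adjacency_matrix_single arcs)
      then show ?case using Suc by (simp add: chain_Suc)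
    qed
    have side_polys: "?cp (Inl v # map Inl ws) = r" "?cp (map Inl ws) = s"
      using side[of "v # ws"] side[of ws] ws P by (auto simp: r_def s_def)
    have "pverts ?K = Inl ` pverts G \<union> Inr ` {..<k}"
      by (rule pverts_k_subdivision[OF uv(3,4)])
    moreover have "set (init k @ tip k # Inl v # map Inl ws) =
        set (init k @ [tip k]) \<union> Inl ` insert v (set ws)"
      by auto
    moreover have "insert v (set ws) = pverts G - P"
      using ws(2) P(2) uv(4) by blast
    ultimately have verts: "set (init k @ tip k # Inl v # map Inl ws) = pverts ?K"
      unfolding set_chain using P(3) by (simp only:) blast
    have "distinct (init k @ tip k # Inl v # map Inl ws)"
    proof (cases k)
      case 0
      then show ?thesis
        using us ws P uv by (auto simp: init_def tip_def distinct_map)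
    next
      case (Suc i)
      have "v \<notin> set us" "v \<notin> set ws" "u \<notin> set us" "u \<notin> set ws" "set us \<inter> set ws = {}"
        using us(2) ws(2) P by auto
      with Suc show ?thesis
        using us(1) ws(1) uv(5) by (auto simp: init_def tip_def distinct_map)
    qed
    then have "graph_char_poly ?K = ?cp (init k @ tip k # Inl v # map Inl ws)"
      using verts by (rule graph_char_poly_eq)
    \<comment> \<open>The bridge joins \<open>tip k\<close> to \<open>v\<close>; for
      \<open>k = 0\<close> it is the cut edge itself.\<close>
    also have "\<dots> = ?cp (init k @ [tip k]) * ?cp (Inl v # map Inl ws) - ?cp (init k) * ?cp (map Inl ws)"
    proof (rule char_poly_adjacency_matrix_bridge[OF tip], unfold set_chain)
      show "Inl v \<notin> set (map Inl ws)"
        using ws(2) by auto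
      fix x y :: "'a + nat" assume x: "x \<in> Inl ` P \<union> Inr ` {..<k}" and "y \<in> set (Inl v # map Inl ws)"
      then obtain b where b: "y = Inl b" "b \<notin> P"
        using ws(2) P(2) by auto
      have across: "(a, b) \<in> parcs G \<longleftrightarrow> a = u \<and> b = v" "(b, a) \<in> parcs G \<longleftrightarrow> a = u \<and> b = v"
        if "a \<in> P" for a
        using cross(1)[of a b] cross(2)[of b a] that b(2) uv(1,2) by blast+
      from x consider a where "x = Inl a" "a \<in> P" | i where "x = Inr i" "i < k"
        by blast
      then show "(x, y) \<in> parcs ?K \<longleftrightarrow> x = tip k \<and> y = Inl v"
        and "(y, x) \<in> parcs ?K \<longleftrightarrow> x = tip k \<and> y = Inl v"
        using P b by (cases; auto simp: arcs across tip_def)+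
    qed
    finally show ?thesis using chain[of k] side_polys by simp
  qed
  then show thesis by (rule that)
qed

text \<open>Both shifts of \<open>path_poly\<close> obey the same linear recurrence, and so does
  their combination with fixed \<open>r\<close> and \<open>s\<close>.\<close>

lemma graph_char_poly_k_subdivision_recurrence:
  assumes "pair_graph G" and "cut_edge G (u, v)"
  shows "graph_char_poly (k_subdivision G (u, v) (Suc (Suc k))) =
    [:0, 1:] * graph_char_poly (k_subdivision G (u, v) (Suc k))
    - graph_char_poly (k_subdivision G (u, v) k)"
proof -
  obtain p q r s where eq: "\<And>k. graph_char_poly (k_subdivision G (u, v) k) =
    path_poly p q (Suc k) * r - path_poly p q k * s"
    by (rule graph_char_poly_k_subdivision[OF assms]) blast
  show ?thesis unfolding eq path_poly.simps by (simp only: algebra_simps)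
qed

lemma coeff_phi_tilde_k_subdivision:
  assumes pg: "pair_graph G" and "bipartite G" and cut: "cut_edge G (u, v)"
  shows "of_int (coeff (graph_char_poly (k_subdivision G (u, v) k)) j) * \<i> ^ j =
    \<i> ^ (card (pverts G) + k) * complex_of_int (coeff (phi_tilde (k_subdivision G (u, v) k)) j)"
proof -
  interpret pair_graph G by fact
  let ?K = "k_subdivision G (u, v) k"
  obtain P where P: "u \<in> P" "v \<notin> P"
    and cross: "\<And>x y. (x, y) \<in> parcs G \<Longrightarrow> x \<in> P \<Longrightarrow> y \<notin> P \<Longrightarrow> x = u \<and> y = v"
      "\<And>x y. (x, y) \<in> parcs G \<Longrightarrow> x \<notin> P \<Longrightarrow> y \<in> P \<Longrightarrow> x = v \<and> y = u"
    by (rule cut_edge_separates[OF pg cut]) blast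
  have uv: "(u, v) \<in> parcs G" "(v, u) \<in> parcs G" "u \<in> pverts G" "v \<in> pverts G"
    using cut arcs_symmetric in_arcsD1 in_arcsD2 by (auto simp: cut_edge_def)
  note arcs = parcs_k_subdivision[OF uv(1,2), where k = k]
  obtain X Y where "X \<inter> Y = {}"
    and XY: "\<forall>(x, y) \<in> parcs G. (x \<in> X \<and> y \<in> Y) \<or> (x \<in> Y \<and> y \<in> X)"
    using assms(2) unfolding bipartite_def by (elim exE conjE)
  then have X: "x \<in> X \<longleftrightarrow> y \<notin> X" if "(x, y) \<in> parcs G" for x y
    using bspec[OF XY that] by auto
  have verts: "pverts ?K = Inl ` pverts G \<union> Inr ` {..<k}"
    by (rule pverts_k_subdivision[OF uv(3,4)])
  \<comment> \<open>The new vertices alternate in colour, starting opposite to \<open>u\<close>. An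
    odd number of them gives \<open>v\<close> the wrong colour, so for odd \<open>k\<close> the
    colours outside \<open>P\<close> are exchanged.\<close>
  define side where "side = case_sum (\<lambda>x. (x \<in> X) = (x \<in> P \<or> even k)) (\<lambda>j::nat. (u \<in> X) = odd j)"
  have "card (pverts ?K) = card (pverts G) + k"
    unfolding verts using pair_finite_verts by (subst card_Un_disjoint) (auto simp: card_image)
  moreover have "of_int (coeff (graph_char_poly ?K) j) * \<i> ^ j =
    \<i> ^ card (pverts ?K) * complex_of_int (coeff (phi_tilde ?K) j)"
  proof (rule coeff_phi_tilde_bipartite)
    show "finite (pverts ?K)"
      unfolding verts using pair_finite_verts by simp
    fix x y assume xy: "(x, y) \<in> parcs ?K"
    then show "(y, x) \<in> parcs ?K"
      by (cases x; cases y) (auto simp: arcs dest: arcs_symmetric)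
    from xy show "side x \<noteq> side y"
      using P X[OF uv(1)] by (cases x; cases y) (auto simp: arcs side_def dest: X cross)
  qed
  ultimately show ?thesis by simp
qed

text \<open>Multiply the recurrence for the signed coefficients by \<open>\<i>^j\<close>. The term
  shifted by \<open>x\<close> supplies the one missing factor \<open>\<i>\<close>, and the term two
  steps back meets \<open>\<i>^2 = -1\<close>, which turns the minus into a plus.\<close>

lemma phi_tilde_k_subdivision_recurrence:
  assumes "pair_graph G" and "bipartite G" and "cut_edge G (u, v)"
  shows "phi_tilde (k_subdivision G (u, v) (Suc (Suc k))) =
    [:0, 1:] * phi_tilde (k_subdivision G (u, v) (Suc k)) + phi_tilde (k_subdivision G (u, v) k)"
proof (rule poly_eqI)
  fix j
  define f where "f k j = complex_of_int (coeff (graph_char_poly (k_subdivision G (u, v) k)) j)" for k j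
  define t where "t k j = complex_of_int (coeff (phi_tilde (k_subdivision G (u, v) k)) j)" for k j
  define n where "n = card (pverts G)"
  have rec: "f (Suc (Suc k)) j = (case j of 0 \<Rightarrow> 0 | Suc l \<Rightarrow> f (Suc k) l) - f k j"
    by (simp add: f_def graph_char_poly_k_subdivision_recurrence[OF assms(1,3)] coeff_pCons split: nat.split)
  have sign: "f k j * \<i> ^ j = \<i> ^ (n + k) * t k j" for k j
    unfolding f_def t_def n_def by (rule coeff_phi_tilde_k_subdivision[OF assms])
  have "\<i> ^ (n + Suc (Suc k)) * t (Suc (Suc k)) j =
      (case j of 0 \<Rightarrow> 0 | Suc l \<Rightarrow> f (Suc k) l * \<i> ^ l * \<i>) - f k j * \<i> ^ j"
    unfolding sign[symmetric] rec by (simp add: algebra_simps split: nat.split)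
  also have "\<dots> = \<i> ^ (n + Suc (Suc k)) * ((case j of 0 \<Rightarrow> 0 | Suc l \<Rightarrow> t (Suc k) l) + t k j)"
    unfolding sign by (simp add: algebra_simps split: nat.split)
  finally have "t (Suc (Suc k)) j = (case j of 0 \<Rightarrow> 0 | Suc l \<Rightarrow> t (Suc k) l) + t k j"
    by simp
  also have "\<dots> = complex_of_int (coeff ([:0, 1:] * phi_tilde (k_subdivision G (u, v) (Suc k))
      + phi_tilde (k_subdivision G (u, v) k)) j)"
    by (simp add: t_def coeff_pCons split: nat.split)
  finally show "coeff (phi_tilde (k_subdivision G (u, v) (Suc (Suc k)))) j =
    coeff ([:0, 1:] * phi_tilde (k_subdivision G (u, v) (Suc k)) + phi_tilde (k_subdivision G (u, v) k)) j"
    unfolding t_def of_int_eq_iff .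
qed

section \<open>Coefficientwise comparison of two sequences\<close>

text \<open>Each new coefficient is a sum of earlier ones, so the inequalities persist; equality of
  two such sums forces equality of the summands.\<close>

lemma poly_recurrence_coeff_mono:
  fixes g h :: "nat \<Rightarrow> int poly"
  assumes g: "\<And>k. g (Suc (Suc k)) = [:0, 1:] * g (Suc k) + g k"
    and h: "\<And>k. h (Suc (Suc k)) = [:0, 1:] * h (Suc k) + h k"
    and le: "\<And>i. coeff (g 0) i \<le> coeff (h 0) i" "\<And>i. coeff (g 1) i \<le> coeff (h 1) i"
  shows "coeff (g k) i \<le> coeff (h k) i"
    and "2 \<le> k \<Longrightarrow> g k = h k \<longleftrightarrow> g 0 = h 0 \<and> g 1 = h 1"
proof -
  have step: "coeff (f (Suc (Suc k))) i = (case i of 0 \<Rightarrow> 0 | Suc l \<Rightarrow> coeff (f (Suc k)) l) + coeff (f k) i"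
    if "\<And>k. f (Suc (Suc k)) = [:0, 1:] * f (Suc k) + f k" for f :: "nat \<Rightarrow> int poly" and k i
    unfolding that by (simp add: coeff_pCons split: nat.split)
  note steps = step[of g, OF g] step[of h, OF h]
  have mono: "coeff (g k) i \<le> coeff (h k) i \<and> coeff (g (Suc k)) i \<le> coeff (h (Suc k)) i" for k i
  proof (induction k arbitrary: i)
    case 0
    then show ?case using le by simp
  next
    case (Suc k)
    then show ?case by (auto simp: steps intro!: add_mono split: nat.split)
  qed
  then show "coeff (g k) i \<le> coeff (h k) i" by blast
  have split: "g (Suc k) = h (Suc k) \<and> g k = h k" if "g (Suc (Suc k)) = h (Suc (Suc k))" for k
  proof -
    \<comment> \<open>Coefficient \<open>Suc i\<close> yields index \<open>i\<close> for the later
      term and \<open>Suc i\<close> for the earlier one; index 0 of the earlier term is treated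
      separately.\<close>
    have "coeff (g (Suc k)) i = coeff (h (Suc k)) i \<and> coeff (g k) (Suc i) = coeff (h k) (Suc i)" for i
      using arg_cong[OF that, of "\<lambda>p. coeff p (Suc i)"] mono[of k "Suc i"] mono[of k i]
      by (simp add: steps)
    moreover have "coeff (g k) 0 = coeff (h k) 0"
      using arg_cong[OF that, of "\<lambda>p. coeff p 0"] by (simp add: steps)
    ultimately show ?thesis
      by (simp add: poly_eq_iff) (metis not0_implies_Suc)
  qed
  have eq: "g k = h k \<and> g (Suc k) = h (Suc k)" if "g 0 = h 0" "g (Suc 0) = h (Suc 0)" for k
    using that by (induction k) (auto simp: g h)
  \<comment> \<open>One equality at index at least 2 gives equality at the two preceding indices,
    and so on down to 0 and 1.\<close>
  have "g 0 = h 0 \<and> g (Suc 0) = h (Suc 0)" if "g (Suc (Suc k)) = h (Suc (Suc k))" for k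
    using that by (induction k) (use split in blast)+
  then show "g k = h k \<longleftrightarrow> g 0 = h 0 \<and> g 1 = h 1" if "2 \<le> k"
    using that eq by (metis One_nat_def Suc_1 Suc_le_D Suc_le_mono)
qed

theorem theorem2p3:
  fixes G :: "'a pair_pre_digraph" and H :: "'b pair_pre_digraph"
    and e :: "'a \<times> 'a" and e' :: "'b \<times> 'b" and n :: nat
  assumes "pair_graph G" and "bipartite G" and "card (pverts G) = n"
    and "pair_graph H" and "bipartite H" and "card (pverts H) = n"
    and "cut_edge G e" and "cut_edge H e'"
    and "k_subdivision G e 0 \<preceq>\<^sub>\<phi> k_subdivision H e' 0"
    and "k_subdivision G e 1 \<preceq>\<^sub>\<phi> k_subdivision H e' 1"
  shows "\<forall>k\<ge>2. k_subdivision G e k \<preceq>\<^sub>\<phi> k_subdivision H e' k \<and>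
    (k_subdivision G e k \<sim>\<^sub>\<phi> k_subdivision H e' k \<longleftrightarrow>
      k_subdivision H e' 0 \<sim>\<^sub>\<phi> k_subdivision G e 0 \<and>
      k_subdivision H e' 1 \<sim>\<^sub>\<phi> k_subdivision G e 1)"
proof (intro allI impI)
  fix k :: nat assume k: "2 \<le> k"
  let ?g = "\<lambda>k. phi_tilde (k_subdivision G e k)"
  let ?h = "\<lambda>k. phi_tilde (k_subdivision H e' k)"
  have g: "?g (Suc (Suc k)) = [:0, 1:] * ?g (Suc k) + ?g k" for k
    using phi_tilde_k_subdivision_recurrence[of G "fst e" "snd e" k] assms by simp
  have h: "?h (Suc (Suc k)) = [:0, 1:] * ?h (Suc k) + ?h k" for k
    using phi_tilde_k_subdivision_recurrence[of H "fst e'" "snd e'" k] assms by simp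
  have le: "coeff (?g 0) i \<le> coeff (?h 0) i" "coeff (?g 1) i \<le> coeff (?h 1) i" for i
    using assms(9,10) by (auto simp: quasi_le_def)
  show "k_subdivision G e k \<preceq>\<^sub>\<phi> k_subdivision H e' k \<and>
    (k_subdivision G e k \<sim>\<^sub>\<phi> k_subdivision H e' k \<longleftrightarrow>
      k_subdivision H e' 0 \<sim>\<^sub>\<phi> k_subdivision G e 0 \<and>
      k_subdivision H e' 1 \<sim>\<^sub>\<phi> k_subdivision G e 1)"
    using poly_recurrence_coeff_mono[of ?g ?h, OF g h le] k
    unfolding quasi_le_def quasi_eq_def by metis
qed

end
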